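(* Let $(V,E)$ be a decomposable lattice-normed space and let $(W,F)$ be a Banach-Kantorovich space with $F$ Dedekind complete. Then a dominated Uryson operator $T:V\to W$ is laterally continuous if and only if its exact dominant $\|T\|:E\to F$ is laterally continuous; that is, $T\in\mathcal{D}_U^n(V,W)\Longleftrightarrow\|T\|\in\mathcal{U}_+^n(E,F)$.
   Context: Lattice-normed spaces. Let $V$ be a real vector space and $E$ a real Archimedean vector lattice. A vector norm is a map $\|\cdot\|:V\to E$ with $\|v\|\ge 0$, $\|v\|=0\Leftrightarrow v=0$, $\|v_1+v_2\|\le\|v_1\|+\|v_2\|$, $\|\lambda v\|=|\lambda|\,\|v\|$ ($\lambda\in\mathbb{R}$). $(V,E)$ is then a lattice-normed space. It is decomposable if whenever $\|x\|=e_1+e_2$ with $e_1,e_2\in E_+$ there are $x_1,x_2\in V$ with $x=x_1+x_2$ and $\|x_k\|=e_k$ ($k=1,2$). Elements $x,y\in V$ are disjoint, $x\perp y$, if $\|x\|\wedge\|y\|=0$. A net $(v_\alpha)$ in $V$ $(bo)$-converges to $v\in V$ if there is a decreasing net $(e_\gamma)_{\gamma\in\Gamma}$ in $E$ with $\inf_\gamma e_\gamma=0$ such that for every $\gamma$ there is an index $\alpha(\gamma)$ with $\|v-v_\alpha\|\le e_\gamma$ for all $\alpha\ge\alpha(\gamma)$. A net $(v_\alpha)$ is $(bo)$-fundamental if the net $(v_\alpha-v_\beta)_{(\alpha,\beta)}$ $(bo)$-converges to $0$; $V$ is $(bo)$-complete if every $(bo)$-fundamental net $(bo)$-converges. A Banach-Kantorovich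 space is a decomposable $(bo)$-complete lattice-normed space. A vector lattice $E$ is regarded as the lattice-normed space $(E,E)$ with norm $|\cdot|$. Operators. A map $S:E\to F$ between vector lattices is orthogonally additive if $S(x+y)=Sx+Sy$ whenever $|x|\wedge|y|=0$; positive if $Sx\ge0$ for all $x\in E$; order bounded if it maps order bounded sets to order bounded sets; even if $S(x)=S(-x)$ for all $x$. An abstract Uryson operator is an orthogonally additive order bounded map. $\mathcal{U}_+^{ev}(E,F)$ is the set of positive even abstract Uryson operators, ordered by $S_1\le S_2$ iff $S_2-S_1$ is positive. A map $T:V\to W$ is orthogonally additive if $T(u+v)=Tu+Tv$ whenever $u\perp v$ in $V$. It is a dominated Uryson operator if it is orthogonally additive and there is $S\in\mathcal{U}_+^{ev}(E,F)$ (a dominant of $T$) with $\|Tv\|\le S\|v\|$ for all $v\in V$. The exact dominant $\|T\|$ is the least dominant of $T$ in $\mathcal{U}_+^{ev}(E,F)$; it exists when $V$ is decomposable and $F$ is Dedekind complete. Lateral continuity. A net $(v_\alpha)_{\alpha\in\Lambda}$ in a lattice-normed space $V$ is laterally convergent to $v$ if it $(bo)$-converges to $v$ and $\|v_\beta-v_\gamma\|\perp\|v_\gamma\|$ for all $\beta\ge\gamma$ in $\Lambda$. An orthogonally additive operator $T:V\to W$ is laterally continuous if for every net $(v_\alpha)$ laterally convergent to $v$ the net $(Tv_\alpha)$ $(bo)$-converges to $Tv$. $\mathcal{D}_U^n(V,W)$ is the set of laterally continuous dominated Uryson operators from $V$ to $W$, and $\mathcal{U}_+^n(E,F)$ is the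 set of laterally continuous positive abstract Uryson operators from $E$ to $F$. *)

theory Defs
  imports Complex_Main "HOL-Library.Lattice_Algebras" "HOL-Library.Lub_Glb"
begin

section \<open>Vector lattices\<close>

class vector_lattice = ordered_real_vector + lattice_ab_group_add_abs

class archimedean_vector_lattice = vector_lattice +
  assumes archimedean: "(\<And>n::nat. of_nat n *\<^sub>R x \<le> y) \<Longrightarrow> x \<le> 0"

text \<open>
  A Dedekind complete vector lattice is a type of sort
  \<open>{archimedean_vector_lattice, conditionally_complete_lattice}\<close>: nonempty sets that are bounded
  above (below) have suprema (infima).
\<close>


section \<open>Nets and order convergence\<close>

text \<open>
  A net is a function restricted to an index set \<open>\<Lambda>\<close> that is directed upwards by a preorder \<open>r\<close>;
  \<open>(\<alpha>, \<beta>) \<in> r\<close> means \<open>\<alpha> \<le> \<beta>\<close>.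
\<close>

definition directed_index :: "'i set \<Rightarrow> 'i rel \<Rightarrow> bool" where
  "directed_index \<Lambda> r \<longleftrightarrow> \<Lambda> \<noteq> {} \<and> preorder_on \<Lambda> r \<and>
     (\<forall>\<alpha>\<in>\<Lambda>. \<forall>\<beta>\<in>\<Lambda>. \<exists>\<gamma>\<in>\<Lambda>. (\<alpha>, \<gamma>) \<in> r \<and> (\<beta>, \<gamma>) \<in> r)"

definition decreasing_to_zero :: "'g set \<Rightarrow> 'g rel \<Rightarrow> ('g \<Rightarrow> 'e::vector_lattice) \<Rightarrow> bool" where
  "decreasing_to_zero \<Gamma> s e \<longleftrightarrow> directed_index \<Gamma> s \<and>
     (\<forall>\<gamma> \<delta>. (\<gamma>, \<delta>) \<in> s \<longrightarrow> e \<delta> \<le> e \<gamma>) \<and> isGlb UNIV (e ` \<Gamma>) 0"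

text \<open>
  HOL cannot quantify over the type of an index set inside a definition. The decreasing net
  \<open>(e\<^sub>\<gamma>)\<close> below is therefore indexed by a subset of the vector lattice itself. This is no
  restriction, see \<open>bo_convergesI\<close>: a decreasing net can be replaced by its range.
\<close>

definition bo_converges ::
  "('v::real_vector \<Rightarrow> 'e::archimedean_vector_lattice) \<Rightarrow> 'i set \<Rightarrow> 'i rel \<Rightarrow> ('i \<Rightarrow> 'v) \<Rightarrow> 'v \<Rightarrow> bool"
where
  "bo_converges p \<Lambda> r v l \<longleftrightarrow>
     (\<exists>(\<Gamma>::'e set) s e. decreasing_to_zero \<Gamma> s e \<and>
        (\<forall>\<gamma>\<in>\<Gamma>. \<exists>\<alpha>\<^sub>0\<in>\<Lambda>. \<forall>\<alpha>\<in>\<Lambda>. (\<alpha>\<^sub>0, \<alpha>) \<in> r \<longrightarrow> p (l - v \<alpha>) \<le> e \<gamma>))"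

definition prod_rel_index :: "'i rel \<Rightarrow> ('i \<times> 'i) rel" where
  "prod_rel_index r = {((\<alpha>, \<beta>), (\<alpha>', \<beta>')). (\<alpha>, \<alpha>') \<in> r \<and> (\<beta>, \<beta>') \<in> r}"

definition bo_fundamental ::
  "('v::real_vector \<Rightarrow> 'e::archimedean_vector_lattice) \<Rightarrow> 'i set \<Rightarrow> 'i rel \<Rightarrow> ('i \<Rightarrow> 'v) \<Rightarrow> bool"
where
  "bo_fundamental p \<Lambda> r v \<longleftrightarrow>
     bo_converges p (\<Lambda> \<times> \<Lambda>) (prod_rel_index r) (\<lambda>(\<alpha>, \<beta>). v \<alpha> - v \<beta>) 0"

text \<open>
  Again an index type has to be fixed. Pairs of a tail and an element of it suffice to represent
  any net as far as order convergence is concerned, see \<open>bo_completeD\<close>.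
\<close>

definition bo_complete :: "('v::real_vector \<Rightarrow> 'e::archimedean_vector_lattice) \<Rightarrow> bool" where
  "bo_complete p \<longleftrightarrow>
     (\<forall>(\<Lambda>::('v set \<times> 'v) set) r v. directed_index \<Lambda> r \<longrightarrow> bo_fundamental p \<Lambda> r v \<longrightarrow>
        (\<exists>l. bo_converges p \<Lambda> r v l))"


section \<open>Lattice-normed spaces\<close>

text \<open>
  The spaces \<open>V\<close> and \<open>E\<close> are types and the space \<open>(V,E)\<close> is given by its vector norm
  \<open>p :: 'v \<Rightarrow> 'e\<close>. A vector lattice regarded as a lattice-normed space has the norm \<open>abs\<close>.
\<close>

locale lattice_normed_space =
  fixes p :: "'v::real_vector \<Rightarrow> 'e::archimedean_vector_lattice"
  assumes norm_nonneg: "0 \<le> p v"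
    and norm_eq_zero_iff: "p v = 0 \<longleftrightarrow> v = 0"
    and norm_triangle: "p (v + w) \<le> p v + p w"
    and norm_scaleR: "p (c *\<^sub>R v) = \<bar>c\<bar> *\<^sub>R p v"

definition decomposable :: "('v::real_vector \<Rightarrow> 'e::archimedean_vector_lattice) \<Rightarrow> bool" where
  "decomposable p \<longleftrightarrow>
     (\<forall>x e1 e2. 0 \<le> e1 \<longrightarrow> 0 \<le> e2 \<longrightarrow> p x = e1 + e2 \<longrightarrow>
        (\<exists>x1 x2. x = x1 + x2 \<and> p x1 = e1 \<and> p x2 = e2))"

definition disjoint_elements ::
  "('v::real_vector \<Rightarrow> 'e::archimedean_vector_lattice) \<Rightarrow> 'v \<Rightarrow> 'v \<Rightarrow> bool" where
  "disjoint_elements p x y \<longleftrightarrow> inf (p x) (p y) = 0"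

definition banach_kantorovich :: "('v::real_vector \<Rightarrow> 'e::archimedean_vector_lattice) \<Rightarrow> bool" where
  "banach_kantorovich p \<longleftrightarrow> lattice_normed_space p \<and> decomposable p \<and> bo_complete p"


section \<open>Orthogonally additive operators\<close>

definition orthogonally_additive ::
  "('v::real_vector \<Rightarrow> 'e::archimedean_vector_lattice) \<Rightarrow> ('v \<Rightarrow> 'w::real_vector) \<Rightarrow> bool" where
  "orthogonally_additive p T \<longleftrightarrow> (\<forall>u v. disjoint_elements p u v \<longrightarrow> T (u + v) = T u + T v)"

definition positive_op :: "('e::vector_lattice \<Rightarrow> 'f::vector_lattice) \<Rightarrow> bool" where
  "positive_op S \<longleftrightarrow> (\<forall>x. 0 \<le> S x)"

definition order_bounded_op :: "('e::vector_lattice \<Rightarrow> 'f::vector_lattice) \<Rightarrow> bool" where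
  "order_bounded_op S \<longleftrightarrow>
     (\<forall>A. bdd_below A \<and> bdd_above A \<longrightarrow> bdd_below (S ` A) \<and> bdd_above (S ` A))"

definition even_op :: "('e::vector_lattice \<Rightarrow> 'f::vector_lattice) \<Rightarrow> bool" where
  "even_op S \<longleftrightarrow> (\<forall>x. S x = S (- x))"

definition abstract_uryson ::
  "('e::archimedean_vector_lattice \<Rightarrow> 'f::archimedean_vector_lattice) \<Rightarrow> bool" where
  "abstract_uryson S \<longleftrightarrow> orthogonally_additive abs S \<and> order_bounded_op S"

definition uryson_pos_even ::
  "('e::archimedean_vector_lattice \<Rightarrow> 'f::archimedean_vector_lattice) set" where
  "uryson_pos_even = {S. abstract_uryson S \<and> positive_op S \<and> even_op S}"

definition uryson_le :: "('e::vector_lattice \<Rightarrow> 'f::vector_lattice) \<Rightarrow> ('e \<Rightarrow> 'f) \<Rightarrow> bool" where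
  "uryson_le S1 S2 \<longleftrightarrow> positive_op (\<lambda>x. S2 x - S1 x)"

definition dominant ::
  "('v::real_vector \<Rightarrow> 'e::archimedean_vector_lattice) \<Rightarrow>
   ('w::real_vector \<Rightarrow> 'f::archimedean_vector_lattice) \<Rightarrow> ('v \<Rightarrow> 'w) \<Rightarrow> ('e \<Rightarrow> 'f) \<Rightarrow> bool" where
  "dominant p q T S \<longleftrightarrow> S \<in> uryson_pos_even \<and> (\<forall>v. q (T v) \<le> S (p v))"

definition dominated_uryson ::
  "('v::real_vector \<Rightarrow> 'e::archimedean_vector_lattice) \<Rightarrow>
   ('w::real_vector \<Rightarrow> 'f::archimedean_vector_lattice) \<Rightarrow> ('v \<Rightarrow> 'w) \<Rightarrow> bool" where
  "dominated_uryson p q T \<longleftrightarrow> orthogonally_additive p T \<and> (\<exists>S. dominant p q T S)"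

definition exact_dominant ::
  "('v::real_vector \<Rightarrow> 'e::archimedean_vector_lattice) \<Rightarrow>
   ('w::real_vector \<Rightarrow> 'f::archimedean_vector_lattice) \<Rightarrow> ('v \<Rightarrow> 'w) \<Rightarrow> ('e \<Rightarrow> 'f)" where
  "exact_dominant p q T =
     (THE S. dominant p q T S \<and> (\<forall>S'. dominant p q T S' \<longrightarrow> uryson_le S S'))"


section \<open>Lateral continuity\<close>

definition laterally_converges ::
  "('v::real_vector \<Rightarrow> 'e::archimedean_vector_lattice) \<Rightarrow> 'i set \<Rightarrow> 'i rel \<Rightarrow> ('i \<Rightarrow> 'v) \<Rightarrow> 'v \<Rightarrow> bool"
where
  "laterally_converges p \<Lambda> r v l \<longleftrightarrow> bo_converges p \<Lambda> r v l \<and>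
     (\<forall>\<beta> \<gamma>. (\<gamma>, \<beta>) \<in> r \<longrightarrow> disjoint_elements abs (p (v \<beta> - v \<gamma>)) (p (v \<gamma>)))"

text \<open>
  Nets indexed by subsets of the domain suffice: a laterally convergent net increases in the
  lateral order, so that it can be indexed by its range. The definition hence covers nets over
  arbitrary directed sets, see \<open>laterally_continuousD\<close>.
\<close>

definition laterally_continuous ::
  "('v::real_vector \<Rightarrow> 'e::archimedean_vector_lattice) \<Rightarrow>
   ('w::real_vector \<Rightarrow> 'f::archimedean_vector_lattice) \<Rightarrow> ('v \<Rightarrow> 'w) \<Rightarrow> bool" where
  "laterally_continuous p q T \<longleftrightarrow>
     (\<forall>(\<Lambda>::'v set) r v l. directed_index \<Lambda> r \<longrightarrow> laterally_converges p \<Lambda> r v l \<longrightarrow>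
        bo_converges q \<Lambda> r (\<lambda>\<alpha>. T (v \<alpha>)) (T l))"

definition lat_cont_dominated ::
  "('v::real_vector \<Rightarrow> 'e::archimedean_vector_lattice) \<Rightarrow>
   ('w::real_vector \<Rightarrow> 'f::archimedean_vector_lattice) \<Rightarrow> ('v \<Rightarrow> 'w) set" where
  "lat_cont_dominated p q = {T. dominated_uryson p q T \<and> laterally_continuous p q T}"

definition lat_cont_uryson_pos ::
  "('e::archimedean_vector_lattice \<Rightarrow> 'f::archimedean_vector_lattice) set" where
  "lat_cont_uryson_pos =
     {S. abstract_uryson S \<and> positive_op S \<and> laterally_continuous abs abs S}"


section \<open>Independence of the index types\<close>

lemma bo_convergesI:
  fixes e :: "'g \<Rightarrow> 'e::archimedean_vector_lattice"
  assumes "decreasing_to_zero \<Gamma> s e"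
    and ev: "\<And>\<gamma>. \<gamma> \<in> \<Gamma> \<Longrightarrow> \<exists>\<alpha>\<^sub>0\<in>\<Lambda>. \<forall>\<alpha>\<in>\<Lambda>. (\<alpha>\<^sub>0, \<alpha>) \<in> r \<longrightarrow> p (l - v \<alpha>) \<le> e \<gamma>"
  shows "bo_converges p \<Lambda> r v l"
proof -
  let ?G = "e ` \<Gamma>" and ?s = "{(a, b). a \<in> e ` \<Gamma> \<and> b \<in> e ` \<Gamma> \<and> b \<le> a}"
  have di: "directed_index \<Gamma> s" and mono: "\<And>\<gamma> \<delta>. (\<gamma>, \<delta>) \<in> s \<Longrightarrow> e \<delta> \<le> e \<gamma>"
    and glb: "isGlb UNIV ?G 0"
    using assms(1) unfolding decreasing_to_zero_def by auto
  have "preorder_on ?G ?s"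
    unfolding preorder_on_def refl_on_def trans_def by (auto intro: order_trans)
  moreover have "\<exists>c\<in>?G. (a, c) \<in> ?s \<and> (b, c) \<in> ?s" if "a \<in> ?G" "b \<in> ?G" for a b
  proof -
    obtain x y where xy: "x \<in> \<Gamma>" "y \<in> \<Gamma>" "a = e x" "b = e y" using \<open>a \<in> ?G\<close> \<open>b \<in> ?G\<close> by blast
    obtain z where "z \<in> \<Gamma>" "(x, z) \<in> s" "(y, z) \<in> s"
      using di xy(1,2) unfolding directed_index_def by blast
    then show ?thesis using mono xy by blast
  qed
  ultimately have "directed_index ?G ?s"
    using di unfolding directed_index_def by simp
  then have "decreasing_to_zero ?G ?s id"
    using glb unfolding decreasing_to_zero_def by auto
  moreover have "\<forall>g\<in>?G. \<exists>\<alpha>\<^sub>0\<in>\<Lambda>. \<forall>\<alpha>\<in>\<Lambda>. (\<alpha>\<^sub>0, \<alpha>) \<in> r \<longrightarrow> p (l - v \<alpha>) \<le> id g"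
    using ev by auto
  ultimately show ?thesis unfolding bo_converges_def by blast
qed

lemma bo_completeD:
  fixes p :: "'v::real_vector \<Rightarrow> 'e::archimedean_vector_lattice" and \<Lambda> :: "'i set"
  assumes comp: "bo_complete p" and di: "directed_index \<Lambda> r" and fund: "bo_fundamental p \<Lambda> r v"
  shows "\<exists>l. bo_converges p \<Lambda> r v l"
proof -
  define tl where "tl \<alpha> = v ` {\<beta>\<in>\<Lambda>. (\<alpha>, \<beta>) \<in> r}" for \<alpha>
  define L where "L = {(A, x). A \<in> tl ` \<Lambda> \<and> x \<in> A}"
  define R where "R = {(a, b). a \<in> L \<and> b \<in> L \<and> fst b \<subseteq> fst a}"
  have rf: "(\<alpha>, \<alpha>) \<in> r" if "\<alpha> \<in> \<Lambda>" for \<alpha>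
    using di that unfolding directed_index_def preorder_on_def refl_on_def by auto
  have tr: "trans r" using di unfolding directed_index_def preorder_on_def by auto
  have inL: "(tl \<alpha>, v \<alpha>) \<in> L" if "\<alpha> \<in> \<Lambda>" for \<alpha>
    using that rf unfolding L_def tl_def by auto
  have anti: "tl \<beta> \<subseteq> tl \<alpha>" if "(\<alpha>, \<beta>) \<in> r" for \<alpha> \<beta>
    using that tr unfolding tl_def trans_def by blast
  have diL: "directed_index L R"
    unfolding directed_index_def
  proof (intro conjI ballI)
    show "L \<noteq> {}" using di inL unfolding directed_index_def by blast
    show "preorder_on L R"
      unfolding preorder_on_def refl_on_def trans_def R_def by auto
    fix a b assume ab: "a \<in> L" "b \<in> L"
    then obtain \<alpha> \<beta> where *: "\<alpha> \<in> \<Lambda>" "\<beta> \<in> \<Lambda>" "fst a = tl \<alpha>" "fst b = tl \<beta>"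
      unfolding L_def by auto
    then obtain \<gamma> where g: "\<gamma> \<in> \<Lambda>" "(\<alpha>, \<gamma>) \<in> r" "(\<beta>, \<gamma>) \<in> r"
      using di unfolding directed_index_def by blast
    then have "(a, (tl \<gamma>, v \<gamma>)) \<in> R" "(b, (tl \<gamma>, v \<gamma>)) \<in> R"
      using * ab inL anti unfolding R_def by auto
    then show "\<exists>c\<in>L. (a, c) \<in> R \<and> (b, c) \<in> R" using inL g by blast
  qed
  obtain G :: "'e set" and s e where dz: "decreasing_to_zero G s e"
    and ev: "\<forall>\<gamma>\<in>G. \<exists>\<alpha>\<^sub>0\<in>\<Lambda> \<times> \<Lambda>. \<forall>\<alpha>\<in>\<Lambda> \<times> \<Lambda>. (\<alpha>\<^sub>0, \<alpha>) \<in> prod_rel_index r \<longrightarrow>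
              p (0 - (case \<alpha> of (\<alpha>, \<beta>) \<Rightarrow> v \<alpha> - v \<beta>)) \<le> e \<gamma>"
    using fund unfolding bo_fundamental_def bo_converges_def by blast
  have "bo_fundamental p L R snd"
    unfolding bo_fundamental_def
  proof (rule bo_convergesI[OF dz])
    fix \<gamma> assume "\<gamma> \<in> G"
    then obtain a b where ab: "a \<in> \<Lambda>" "b \<in> \<Lambda>"
      and e: "\<And>a' b'. a' \<in> \<Lambda> \<Longrightarrow> b' \<in> \<Lambda> \<Longrightarrow> (a, a') \<in> r \<Longrightarrow> (b, b') \<in> r \<Longrightarrow>
                p (0 - (v a' - v b')) \<le> e \<gamma>"
      using ev unfolding prod_rel_index_def by fastforce
    have "p (0 - (snd x - snd y)) \<le> e \<gamma>"
      if "((tl a, v a), x) \<in> R" "((tl b, v b), y) \<in> R" for x y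
    proof -
      have "snd x \<in> tl a" "snd y \<in> tl b" using that unfolding R_def L_def by auto
      then show ?thesis using e unfolding tl_def by auto
    qed
    then show "\<exists>\<alpha>\<^sub>0\<in>L \<times> L. \<forall>\<alpha>\<in>L \<times> L. (\<alpha>\<^sub>0, \<alpha>) \<in> prod_rel_index R \<longrightarrow>
              p (0 - (case \<alpha> of (\<alpha>, \<beta>) \<Rightarrow> snd \<alpha> - snd \<beta>)) \<le> e \<gamma>"
      using inL ab unfolding prod_rel_index_def
      by (intro bexI[of _ "((tl a, v a), (tl b, v b))"]) auto
  qed
  then obtain l where "bo_converges p L R snd l"
    using comp diL unfolding bo_complete_def by blast
  then obtain G :: "'e set" and s e where dz: "decreasing_to_zero G s e"
    and ev: "\<forall>\<gamma>\<in>G. \<exists>\<alpha>\<^sub>0\<in>L. \<forall>\<alpha>\<in>L. (\<alpha>\<^sub>0, \<alpha>) \<in> R \<longrightarrow> p (l - snd \<alpha>) \<le> e \<gamma>"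
    unfolding bo_converges_def by blast
  have "bo_converges p \<Lambda> r v l"
  proof (rule bo_convergesI[OF dz])
    fix \<gamma> assume "\<gamma> \<in> G"
    then obtain a where a: "a \<in> L" "\<And>b. (a, b) \<in> R \<Longrightarrow> p (l - snd b) \<le> e \<gamma>"
      using ev unfolding R_def by blast
    then obtain \<alpha> where \<alpha>: "\<alpha> \<in> \<Lambda>" "fst a = tl \<alpha>" unfolding L_def by auto
    have "p (l - v \<beta>) \<le> e \<gamma>" if "\<beta> \<in> \<Lambda>" "(\<alpha>, \<beta>) \<in> r" for \<beta>
      using a(2)[of "(tl \<beta>, v \<beta>)"] a(1) \<alpha> anti[OF that(2)] inL[OF that(1)] unfolding R_def by auto
    then show "\<exists>\<alpha>\<^sub>0\<in>\<Lambda>. \<forall>\<alpha>\<in>\<Lambda>. (\<alpha>\<^sub>0, \<alpha>) \<in> r \<longrightarrow> p (l - v \<alpha>) \<le> e \<gamma>" using \<alpha> by blast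
  qed
  then show ?thesis ..
qed

lemma inf_add_le:
  fixes a b c :: "'e::vector_lattice"
  assumes "0 \<le> a" "0 \<le> b" "0 \<le> c"
  shows "inf (a + b) c \<le> inf a c + inf b c"
proof -
  have "inf (a + b) c \<le> a + b" "inf (a + b) c \<le> c" by auto
  moreover have "c \<le> a + c" "c \<le> c + b" "c \<le> c + c" using assms by auto
  ultimately have "inf (a + b) c \<le> inf (inf (a + b) (a + c)) (inf (c + b) (c + c))"
    by (meson le_inf_iff order_trans)
  also have "\<dots> = inf a c + inf b c"
    by (simp add: add_inf_distrib_left add_inf_distrib_right inf_assoc inf_left_commute)
  finally show ?thesis .
qed

context lattice_normed_space
begin

lemma norm_zero [simp]: "p 0 = 0"
  using norm_eq_zero_iff by simp

lemma norm_minus [simp]: "p (- x) = p x"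
  using norm_scaleR[of "-1" x] by simp

lemma disjoint_elements_abs_iff: "disjoint_elements abs (p x) (p y) \<longleftrightarrow> inf (p x) (p y) = 0"
  by (simp add: disjoint_elements_def norm_nonneg)

lemma disjoint_mono:
  assumes "inf (p a) (p b) = 0" "0 \<le> c" "c \<le> p a" "0 \<le> d" "d \<le> p b"
  shows "inf c d = 0"
proof (rule antisym)
  show "inf c d \<le> 0" using assms(1) inf_mono[OF assms(3,5)] by simp
qed (use assms in simp)

lemma norm_le_disjoint_add:
  assumes "inf (p x) (p y) = 0"
  shows "p x \<le> p (x + y)"
proof -
  have "p x \<le> p (x + y) + p y" using norm_triangle[of "x + y" "- y"] by simp
  then have "p x = inf (p (x + y) + p y) (p x)" by (simp add: inf_absorb2)
  also have "\<dots> \<le> inf (p (x + y)) (p x) + inf (p y) (p x)"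
    by (intro inf_add_le norm_nonneg)
  also have "\<dots> = inf (p (x + y)) (p x)" using assms by (simp add: inf_commute)
  finally show ?thesis by simp
qed

text \<open>Transitivity of the lateral order, in which \<open>x\<close> precedes \<open>y\<close> iff \<open>y - x\<close> is disjoint from \<open>x\<close>.\<close>

lemma lateral_trans:
  assumes "inf (p (y - x)) (p x) = 0" "inf (p (z - y)) (p y) = 0"
  shows "inf (p (z - x)) (p x) = 0"
proof (rule antisym)
  have le: "p x \<le> p y" using norm_le_disjoint_add[of x "y - x"] assms(1) by (simp add: inf_commute)
  have "inf (p (z - x)) (p x) \<le> inf (p (z - y) + p (y - x)) (p x)"
    using norm_triangle[of "z - y" "y - x"] by (intro inf_mono) auto
  also have "\<dots> \<le> inf (p (z - y)) (p x) + inf (p (y - x)) (p x)"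
    by (intro inf_add_le norm_nonneg)
  also have "\<dots> = 0" using assms(1) disjoint_mono[OF assms(2), of "p (z - y)" "p x"] le norm_nonneg
    by simp
  finally show "inf (p (z - x)) (p x) \<le> 0" .
qed (simp add: norm_nonneg)

lemma laterally_converges_limit:
  assumes di: "directed_index \<Lambda> r" and lc: "laterally_converges p \<Lambda> r v l" and "\<alpha> \<in> \<Lambda>"
  shows "inf (p (l - v \<alpha>)) (p (v \<alpha>)) = 0"
proof (rule antisym)
  obtain G :: "'e set" and s e where dz: "decreasing_to_zero G s e"
    and ev: "\<forall>\<gamma>\<in>G. \<exists>\<alpha>\<^sub>0\<in>\<Lambda>. \<forall>\<alpha>\<in>\<Lambda>. (\<alpha>\<^sub>0, \<alpha>) \<in> r \<longrightarrow> p (l - v \<alpha>) \<le> e \<gamma>"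
    using lc unfolding laterally_converges_def bo_converges_def by blast
  have "inf (p (l - v \<alpha>)) (p (v \<alpha>)) \<le> e \<gamma>" if "\<gamma> \<in> G" for \<gamma>
  proof -
    obtain a where a: "a \<in> \<Lambda>" "\<And>b. b \<in> \<Lambda> \<Longrightarrow> (a, b) \<in> r \<Longrightarrow> p (l - v b) \<le> e \<gamma>"
      using ev \<open>\<gamma> \<in> G\<close> by blast
    obtain b where b: "b \<in> \<Lambda>" "(a, b) \<in> r" "(\<alpha>, b) \<in> r"
      using di a(1) \<open>\<alpha> \<in> \<Lambda>\<close> unfolding directed_index_def by blast
    have 0: "inf (p (v b - v \<alpha>)) (p (v \<alpha>)) = 0"
      using lc b(3) unfolding laterally_converges_def disjoint_elements_abs_iff by blast
    have "inf (p (l - v \<alpha>)) (p (v \<alpha>)) \<le> inf (p (l - v b) + p (v b - v \<alpha>)) (p (v \<alpha>))"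
      using norm_triangle[of "l - v b" "v b - v \<alpha>"] by (intro inf_mono) auto
    also have "\<dots> \<le> inf (p (l - v b)) (p (v \<alpha>)) + inf (p (v b - v \<alpha>)) (p (v \<alpha>))"
      by (intro inf_add_le norm_nonneg)
    also have "\<dots> \<le> p (l - v b)" using 0 by simp
    finally show ?thesis using a(2) b by (meson order_trans)
  qed
  then show "inf (p (l - v \<alpha>)) (p (v \<alpha>)) \<le> 0"
    using dz unfolding decreasing_to_zero_def isGlb_def isLb_def greatestP_def setle_def setge_def
    by simp
qed (simp add: norm_nonneg)

lemma laterally_continuousD:
  fixes T :: "'v \<Rightarrow> 'w::real_vector" and q :: "'w \<Rightarrow> 'f::archimedean_vector_lattice"
    and \<Lambda> :: "'i set"
  assumes cont: "laterally_continuous p q T" and di: "directed_index \<Lambda> r"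
    and lc: "laterally_converges p \<Lambda> r v l"
  shows "bo_converges q \<Lambda> r (\<lambda>\<alpha>. T (v \<alpha>)) (T l)"
proof -
  define L where "L = v ` \<Lambda>"
  define R where "R = {(x, y). x \<in> L \<and> y \<in> L \<and> inf (p (y - x)) (p x) = 0}"
  have mono: "(v \<alpha>, v \<beta>) \<in> R" if "(\<alpha>, \<beta>) \<in> r" for \<alpha> \<beta>
  proof -
    have "\<alpha> \<in> \<Lambda>" "\<beta> \<in> \<Lambda>" using di that unfolding directed_index_def preorder_on_def by auto
    moreover have "inf (p (v \<beta> - v \<alpha>)) (p (v \<alpha>)) = 0"
      using lc that unfolding laterally_converges_def disjoint_elements_abs_iff by blast
    ultimately show ?thesis unfolding R_def L_def by blast
  qed
  have diL: "directed_index L R"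
    unfolding directed_index_def
  proof (intro conjI ballI)
    show "L \<noteq> {}" using di unfolding L_def directed_index_def by blast
    have "trans R" unfolding trans_def R_def using lateral_trans by blast
    then show "preorder_on L R"
      unfolding preorder_on_def refl_on_def R_def by (auto simp: norm_nonneg inf_absorb1)
    fix x y assume "x \<in> L" "y \<in> L"
    then obtain \<alpha> \<beta> where *: "\<alpha> \<in> \<Lambda>" "\<beta> \<in> \<Lambda>" "x = v \<alpha>" "y = v \<beta>" unfolding L_def by auto
    then obtain \<gamma> where "\<gamma> \<in> \<Lambda>" "(\<alpha>, \<gamma>) \<in> r" "(\<beta>, \<gamma>) \<in> r"
      using di unfolding directed_index_def by blast
    then show "\<exists>z\<in>L. (x, z) \<in> R \<and> (y, z) \<in> R" using mono * unfolding L_def by blast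
  qed
  obtain G :: "'e set" and s e where dz: "decreasing_to_zero G s e"
    and ev: "\<forall>\<gamma>\<in>G. \<exists>\<alpha>\<^sub>0\<in>\<Lambda>. \<forall>\<alpha>\<in>\<Lambda>. (\<alpha>\<^sub>0, \<alpha>) \<in> r \<longrightarrow> p (l - v \<alpha>) \<le> e \<gamma>"
    using lc unfolding laterally_converges_def bo_converges_def by blast
  have "bo_converges p L R id l"
  proof (rule bo_convergesI[OF dz])
    fix \<gamma> assume "\<gamma> \<in> G"
    then obtain a where a: "a \<in> \<Lambda>" "\<And>b. b \<in> \<Lambda> \<Longrightarrow> (a, b) \<in> r \<Longrightarrow> p (l - v b) \<le> e \<gamma>"
      using ev by blast
    have "(a, a) \<in> r"
      using di a(1) unfolding directed_index_def preorder_on_def refl_on_def by auto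
    then have ea: "p (l - v a) \<le> e \<gamma>" using a by blast
    have "p (l - id w) \<le> e \<gamma>" if w: "(v a, w) \<in> R" for w
    proof -
      obtain \<beta> where \<beta>: "\<beta> \<in> \<Lambda>" "w = v \<beta>" using w unfolding R_def L_def by auto
      have 1: "inf (p (w - v a)) (p (v a)) = 0" using w unfolding R_def by auto
      have 2: "inf (p (l - w)) (p w) = 0"
        using laterally_converges_limit[OF di lc \<beta>(1)] \<beta>(2) by simp
      have "p (w - v a) \<le> p w" using norm_le_disjoint_add[OF 1] by simp
      then have "inf (p (l - w)) (p (w - v a)) = 0"
        using disjoint_mono[OF 2] norm_nonneg by simp
      then have "p (l - w) \<le> p (l - v a)" using norm_le_disjoint_add[of "l - w" "w - v a"] by simp
      then show ?thesis using ea by simp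
    qed
    then show "\<exists>\<alpha>\<^sub>0\<in>L. \<forall>\<alpha>\<in>L. (\<alpha>\<^sub>0, \<alpha>) \<in> R \<longrightarrow> p (l - id \<alpha>) \<le> e \<gamma>"
      using a(1) unfolding L_def by blast
  qed
  then have "laterally_converges p L R id l"
    unfolding laterally_converges_def disjoint_elements_abs_iff by (auto simp: R_def)
  then have "bo_converges q L R (\<lambda>w. T (id w)) (T l)"
    using cont diL unfolding laterally_continuous_def by blast
  then obtain G :: "'f set" and s e where dz: "decreasing_to_zero G s e"
    and ev: "\<forall>\<gamma>\<in>G. \<exists>\<alpha>\<^sub>0\<in>L. \<forall>\<alpha>\<in>L. (\<alpha>\<^sub>0, \<alpha>) \<in> R \<longrightarrow> q (T l - T (id \<alpha>)) \<le> e \<gamma>"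
    unfolding bo_converges_def by blast
  show ?thesis
  proof (rule bo_convergesI[OF dz])
    fix \<gamma> assume "\<gamma> \<in> G"
    then obtain a where a: "a \<in> \<Lambda>" "\<And>w. (v a, w) \<in> R \<Longrightarrow> q (T l - T w) \<le> e \<gamma>"
      using ev \<open>\<gamma> \<in> G\<close> unfolding L_def R_def by fastforce
    then show "\<exists>\<alpha>\<^sub>0\<in>\<Lambda>. \<forall>\<alpha>\<in>\<Lambda>. (\<alpha>\<^sub>0, \<alpha>) \<in> r \<longrightarrow> q (T l - T (v \<alpha>)) \<le> e \<gamma>"
      using mono by blast
  qed
qed

end

end

theory Submission
  imports Defs
begin

text \<open>
  The proof rests on a formula for the exact dominant: \<open>\<bar>T\<bar> e\<close> is the supremum of the sums
  \<open>\<Sum>\<^sub>i \<parallel>T v\<^sub>i\<parallel>\<close> over all finite disjoint families \<open>v\<^sub>1, \<dots>, v\<^sub>n\<close> in \<open>V\<close> for which \<open>\<Sum>\<^sub>i \<parallel>v\<^sub>i\<parallel>\<close> is a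
  fragment of \<open>\<bar>e\<bar>\<close>, that is, disjoint from \<open>\<bar>e\<bar> - \<Sum>\<^sub>i \<parallel>v\<^sub>i\<parallel>\<close>. Allowing a fragment instead of \<open>\<bar>e\<bar>\<close>
  itself matters because \<open>\<bar>e\<bar>\<close> need not be the norm of any vector. Every dominant \<open>S\<close> satisfies
  \<open>\<Sum>\<^sub>i \<parallel>T v\<^sub>i\<parallel> \<le> \<Sum>\<^sub>i S \<parallel>v\<^sub>i\<parallel> = S (\<Sum>\<^sub>i \<parallel>v\<^sub>i\<parallel>) \<le> S \<bar>e\<bar>\<close>, so the supremum exists and lies below \<open>S\<close>; that it is
  itself orthogonally additive follows from decomposability, which cuts a vector of norm at most
  \<open>\<bar>e\<bar> + \<bar>f\<bar>\<close>, with \<open>e\<close> and \<open>f\<close> disjoint, into a part under \<open>\<bar>e\<bar>\<close> and a part under \<open>\<bar>f\<bar>\<close>.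

  If \<open>\<bar>T\<bar>\<close> is laterally continuous and \<open>v\<^sub>\<alpha>\<close> converges laterally to \<open>v\<close>, then \<open>\<parallel>v\<^sub>\<alpha>\<parallel>\<close> converges
  laterally to \<open>\<parallel>v\<parallel>\<close> because norms add on disjoint vectors, and
  \<open>\<parallel>T v - T v\<^sub>\<alpha>\<parallel> = \<parallel>T (v - v\<^sub>\<alpha>)\<parallel> \<le> \<bar>T\<bar> \<parallel>v - v\<^sub>\<alpha>\<parallel> = \<bar>T\<bar> \<parallel>v\<parallel> - \<bar>T\<bar> \<parallel>v\<^sub>\<alpha>\<parallel>\<close>.

  Conversely, let \<open>T\<close> be laterally continuous and let \<open>e\<^sub>\<alpha>\<close> converge laterally to \<open>e\<close>. Since
  \<open>\<bar>T\<bar> e - \<bar>T\<bar> e\<^sub>\<alpha>\<close> decreases, only its infimum is at stake. Cut each member of a family that is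
  admissible for \<open>e\<close> along \<open>\<bar>e\<bar> = \<bar>e\<^sub>\<alpha>\<bar> + \<bar>e - e\<^sub>\<alpha>\<bar>\<close>. The parts under \<open>\<bar>e\<^sub>\<alpha>\<bar>\<close> are admissible for
  \<open>e\<^sub>\<alpha>\<close>, and for fixed \<open>i\<close> the cut vectors converge laterally to \<open>v\<^sub>i\<close>. Therefore
  \<open>\<Sum>\<^sub>i \<parallel>T v\<^sub>i\<parallel>\<close> exceeds \<open>\<bar>T\<bar> e\<^sub>\<alpha>\<close> by at most a net that converges to zero in order, and passing
  to the supremum over the families gives \<open>\<bar>T\<bar> e \<le> sup\<^sub>\<alpha> \<bar>T\<bar> e\<^sub>\<alpha>\<close>.
\<close>


section \<open>Disjointness in vector lattices\<close>

lemma disjoint_add_eq_sup: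
  fixes a b :: "'e::vector_lattice"
  assumes "inf a b = 0"
  shows "a + b = sup a b"
  using add_eq_inf_sup[of a b] assms by simp

lemma inf_disjoint_add:
  fixes a b c :: "'e::vector_lattice"
  assumes "0 \<le> a" "inf b c = 0" "a \<le> b + c"
  shows "inf a b + inf a c = a"
proof (rule antisym)
  have bc: "0 \<le> b" "0 \<le> c" using assms(2) by (metis inf.cobounded1, metis inf.cobounded2)
  have "inf (inf a b) (inf a c) = inf a (inf b c)" by (simp add: inf_assoc inf_left_commute)
  then have "inf (inf a b) (inf a c) = 0" using assms by (simp add: inf_absorb2)
  then show "inf a b + inf a c \<le> a" by (simp add: disjoint_add_eq_sup)
  have "a = inf (b + c) a" using assms(3) by (simp add: inf_absorb2)
  also have "\<dots> \<le> inf b a + inf c a" using inf_add_le bc assms(1) .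
  finally show "a \<le> inf a b + inf a c" by (simp add: inf_commute)
qed

lemma disjoint_below:
  fixes a b c d :: "'e::vector_lattice"
  assumes "inf a b = 0" "0 \<le> c" "c \<le> a" "0 \<le> d" "d \<le> b"
  shows "inf c d = 0"
  using assms inf_mono[OF assms(3,5)] by (simp add: antisym)

lemma disjoint_add:
  fixes a b c :: "'e::vector_lattice"
  assumes "inf a c = 0" "inf b c = 0"
  shows "inf (a + b) c = 0"
proof (rule antisym)
  have nn: "0 \<le> a" "0 \<le> b" "0 \<le> c"
    using assms by (metis inf.cobounded1, metis inf.cobounded1, metis inf.cobounded2)
  show "inf (a + b) c \<le> 0" using inf_add_le[OF nn] assms by simp
  show "0 \<le> inf (a + b) c" using nn by simp
qed

lemma disjoint_sum_list:
  fixes c :: "'e::vector_lattice"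
  assumes "0 \<le> c" "\<And>a. a \<in> set as \<Longrightarrow> inf a c = 0"
  shows "inf (sum_list as) c = 0"
  using assms(2) by (induction as) (simp_all add: assms(1) inf_absorb1 disjoint_add)

text \<open>Disjoint elements have their supremum as sum, hence the sum obeys a common upper bound.\<close>

lemma disjoint_sum_list_le:
  fixes c :: "'e::vector_lattice"
  assumes "sorted_wrt (\<lambda>a b. inf a b = 0) as" "0 \<le> c" "\<And>a. a \<in> set as \<Longrightarrow> 0 \<le> a \<and> a \<le> c"
  shows "sum_list as \<le> c"
  using assms(1,3)
proof (induction as)
  case (Cons a as)
  have "inf (sum_list as) a = 0"
    using Cons.prems by (intro disjoint_sum_list) (auto simp: inf_commute)
  then have "a + sum_list as = sup a (sum_list as)"
    by (simp add: disjoint_add_eq_sup inf_commute)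
  then show ?case using Cons by simp
qed (use assms in simp)

lemma pprt_nprt_disjoint:
  fixes e :: "'e::vector_lattice"
  shows "inf \<bar>pprt e\<bar> \<bar>nprt e\<bar> = 0"
proof -
  have "pprt e = e - nprt e" using prts[of e] by (metis add_diff_cancel_right')
  then have "inf (pprt e) (- nprt e) = inf (e + - nprt e) (0 + - nprt e)" by simp
  also have "\<dots> = inf e 0 - nprt e" by (simp only: add_inf_distrib_right[symmetric] diff_conv_add_uminus)
  also have "\<dots> = 0" by (simp add: nprt_def)
  finally show ?thesis by simp
qed

lemma abs_scaleR_vector_lattice:
  fixes v :: "'e::vector_lattice"
  shows "\<bar>c *\<^sub>R v\<bar> = \<bar>c\<bar> *\<^sub>R \<bar>v\<bar>"
proof -
  have le: "\<bar>c *\<^sub>R v\<bar> \<le> \<bar>c\<bar> *\<^sub>R \<bar>v\<bar>" for c and v :: 'e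
  proof (rule abs_leI)
    have *: "d *\<^sub>R w \<le> d *\<^sub>R \<bar>v\<bar>" if "0 \<le> d" "w = v \<or> w = - v" for d w
      using that by (auto intro!: scaleR_left_mono simp: abs_ge_self abs_ge_minus_self)
    show "c *\<^sub>R v \<le> \<bar>c\<bar> *\<^sub>R \<bar>v\<bar>"
      using *[of "\<bar>c\<bar>" v] *[of "\<bar>c\<bar>" "- v"] by (cases "0 \<le> c") auto
    show "- (c *\<^sub>R v) \<le> \<bar>c\<bar> *\<^sub>R \<bar>v\<bar>"
      using *[of "\<bar>c\<bar>" v] *[of "\<bar>c\<bar>" "- v"] by (cases "0 \<le> c") auto
  qed
  show ?thesis
  proof (cases "c = 0")
    case False
    \<comment> \<open>The reverse inequality is the first one for the inverse scalar.\<close>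
    have "\<bar>c\<bar> *\<^sub>R \<bar>inverse c *\<^sub>R c *\<^sub>R v\<bar> \<le> \<bar>c\<bar> *\<^sub>R (\<bar>inverse c\<bar> *\<^sub>R \<bar>c *\<^sub>R v\<bar>)"
      by (intro scaleR_left_mono le) simp
    then show ?thesis using False le[of c v] by (simp add: abs_mult[symmetric] antisym)
  qed simp
qed

lemma lattice_normed_space_abs:
  "lattice_normed_space (abs :: 'e::archimedean_vector_lattice \<Rightarrow> 'e)"
  by unfold_locales (simp_all add: abs_scaleR_vector_lattice abs_triangle_ineq)

interpretation abs: lattice_normed_space "abs :: 'e::archimedean_vector_lattice \<Rightarrow> 'e"
  by (rule lattice_normed_space_abs)

text \<open>In a lattice that is not totally ordered \<open>\<bar>e\<bar>\<close> is in general neither \<open>e\<close> nor \<open>- e\<close>;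
  evenness has to be applied to the negative part alone.\<close>

lemma even_orthogonally_additive_abs:
  assumes "orthogonally_additive abs S" "even_op S"
  shows "S \<bar>e\<bar> = S e"
proof -
  have add: "S (a + b) = S a + S b" if "inf \<bar>a\<bar> \<bar>b\<bar> = 0" for a b
    using assms(1) that unfolding orthogonally_additive_def disjoint_elements_def by blast
  have "S \<bar>e\<bar> = S (pprt e + - nprt e)" by (simp add: abs_prts)
  also have "\<dots> = S (pprt e) + S (- nprt e)"
    by (rule add) (use pprt_nprt_disjoint[of e] in simp)
  also have "\<dots> = S (pprt e) + S (nprt e)" using assms(2) unfolding even_op_def by metis
  also have "\<dots> = S (pprt e + nprt e)" using add pprt_nprt_disjoint by metis
  finally show ?thesis using prts by metis
qed


section \<open>Decomposition of vectors and lateral convergence\<close>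

context lattice_normed_space
begin

lemma norm_disjoint_add:
  assumes "inf (p x) (p y) = 0"
  shows "p (x + y) = p x + p y"
proof (rule antisym)
  have "p y \<le> p (x + y)"
    using norm_le_disjoint_add[of y x] assms by (simp add: inf_commute add.commute)
  then show "p x + p y \<le> p (x + y)"
    using norm_le_disjoint_add[OF assms] by (simp add: disjoint_add_eq_sup[OF assms])
qed (rule norm_triangle)

lemma decompose_disjoint:
  assumes "decomposable p" "inf a b = 0" "p v \<le> a + b"
  shows "\<exists>x. p x = inf (p v) a \<and> p (v - x) = inf (p v) b"
proof -
  have "0 \<le> a" "0 \<le> b" using assms(2) by (metis inf.cobounded1, metis inf.cobounded2)
  then have "0 \<le> inf (p v) a" "0 \<le> inf (p v) b" by (simp_all add: norm_nonneg)
  moreover have "p v = inf (p v) a + inf (p v) b"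
    using inf_disjoint_add[OF norm_nonneg assms(2,3)] by simp
  ultimately obtain x y where "v = x + y" "p x = inf (p v) a" "p y = inf (p v) b"
    using assms(1) unfolding decomposable_def by metis
  then show ?thesis by (intro exI[of _ x]) simp
qed

text \<open>Along a laterally convergent net the distance to the limit decreases, not only eventually
  but at every step: \<open>l - v\<^sub>\<alpha>\<close> is the disjoint sum of \<open>l - v\<^sub>\<beta>\<close> and \<open>v\<^sub>\<beta> - v\<^sub>\<alpha>\<close>.\<close>

lemma laterally_converges_residual:
  assumes di: "directed_index \<Lambda> r" and lc: "laterally_converges p \<Lambda> r v l" and "(\<alpha>, \<beta>) \<in> r"
  shows "p (l - v \<beta>) \<le> p (l - v \<alpha>)"
proof -
  have "\<beta> \<in> \<Lambda>" using di assms(3) unfolding directed_index_def preorder_on_def by auto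
  have "inf (p (v \<beta> - v \<alpha>)) (p (v \<alpha>)) = 0"
    using lc assms(3) unfolding laterally_converges_def disjoint_elements_abs_iff by blast
  then have "p (v \<beta> - v \<alpha>) \<le> p (v \<beta>)"
    using norm_le_disjoint_add[of "v \<beta> - v \<alpha>" "v \<alpha>"] by simp
  then have "inf (p (l - v \<beta>)) (p (v \<beta> - v \<alpha>)) = 0"
    using disjoint_mono[OF laterally_converges_limit[OF di lc \<open>\<beta> \<in> \<Lambda>\<close>]] norm_nonneg by simp
  then show ?thesis using norm_le_disjoint_add[of "l - v \<beta>" "v \<beta> - v \<alpha>"] by simp
qed

lemma norm_laterally_converges:
  assumes di: "directed_index \<Lambda> r" and lc: "laterally_converges p \<Lambda> r v l"
  shows "laterally_converges abs \<Lambda> r (\<lambda>\<alpha>. p (v \<alpha>)) (p l)"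
proof -
  have eq: "p x - p y = p (x - y)" if "inf (p (x - y)) (p y) = 0" for x y
    using norm_disjoint_add[OF that] by simp
  have lim: "\<bar>p l - p (v \<alpha>)\<bar> = p (l - v \<alpha>)" if "\<alpha> \<in> \<Lambda>" for \<alpha>
    using eq[OF laterally_converges_limit[OF di lc that]] by (simp add: norm_nonneg)
  have "disjoint_elements abs \<bar>p (v \<beta>) - p (v \<gamma>)\<bar> \<bar>p (v \<gamma>)\<bar>" if "(\<gamma>, \<beta>) \<in> r" for \<beta> \<gamma>
  proof -
    have "inf (p (v \<beta> - v \<gamma>)) (p (v \<gamma>)) = 0"
      using lc that unfolding laterally_converges_def disjoint_elements_abs_iff by blast
    then show ?thesis using eq by (simp add: disjoint_elements_def norm_nonneg)
  qed
  moreover have "bo_converges abs \<Lambda> r (\<lambda>\<alpha>. p (v \<alpha>)) (p l)"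
    using lc lim unfolding laterally_converges_def bo_converges_def by auto
  ultimately show ?thesis unfolding laterally_converges_def by simp
qed

text \<open>The parts that a laterally convergent net \<open>w\<^sub>\<alpha> \<rightarrow> e\<close> in \<open>E\<close> cuts out of a vector \<open>v\<close> form a
  laterally convergent net in \<open>V\<close>. Coherence between different indices is automatic:
  \<open>x\<^sub>\<beta> - x\<^sub>\<alpha>\<close> is the difference of the two remainders, both of which lie under \<open>\<bar>e - w\<^sub>\<alpha>\<bar>\<close>
  and are therefore disjoint from \<open>x\<^sub>\<alpha>\<close>.\<close>

lemma laterally_converges_cut:
  assumes di: "directed_index \<Lambda> r" and lc: "laterally_converges abs \<Lambda> r w e"
    and x: "\<And>\<alpha>. \<alpha> \<in> \<Lambda> \<Longrightarrow> p (x \<alpha>) \<le> \<bar>w \<alpha>\<bar>" "\<And>\<alpha>. \<alpha> \<in> \<Lambda> \<Longrightarrow> p (v - x \<alpha>) \<le> \<bar>e - w \<alpha>\<bar>"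
  shows "laterally_converges p \<Lambda> r x v"
proof -
  obtain G :: "'e set" and s g where dz: "decreasing_to_zero G s g"
    and ev: "\<forall>\<gamma>\<in>G. \<exists>\<alpha>\<^sub>0\<in>\<Lambda>. \<forall>\<alpha>\<in>\<Lambda>. (\<alpha>\<^sub>0, \<alpha>) \<in> r \<longrightarrow> \<bar>e - w \<alpha>\<bar> \<le> g \<gamma>"
    using lc unfolding laterally_converges_def bo_converges_def by blast
  have "bo_converges p \<Lambda> r x v"
  proof (rule bo_convergesI[OF dz])
    fix \<gamma> assume "\<gamma> \<in> G"
    then show "\<exists>\<alpha>\<^sub>0\<in>\<Lambda>. \<forall>\<alpha>\<in>\<Lambda>. (\<alpha>\<^sub>0, \<alpha>) \<in> r \<longrightarrow> p (v - x \<alpha>) \<le> g \<gamma>"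
      using ev x(2) by (meson order_trans)
  qed
  moreover have "disjoint_elements abs (p (x \<beta> - x \<alpha>)) (p (x \<alpha>))" if r: "(\<alpha>, \<beta>) \<in> r" for \<alpha> \<beta>
  proof -
    have in\<Lambda>: "\<alpha> \<in> \<Lambda>" "\<beta> \<in> \<Lambda>" using di r unfolding directed_index_def preorder_on_def by auto
    have "p (x \<beta> - x \<alpha>) \<le> p (v - x \<alpha>) + p (v - x \<beta>)"
      using norm_triangle[of "v - x \<alpha>" "- (v - x \<beta>)"] by (simp only: norm_minus) simp
    also have "\<dots> \<le> \<bar>e - w \<alpha>\<bar> + \<bar>e - w \<alpha>\<bar>"
      using x(2)[OF in\<Lambda>(1)] order_trans[OF x(2)[OF in\<Lambda>(2)] abs.laterally_converges_residual[OF di lc r]]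
      by (rule add_mono)
    finally have le: "p (x \<beta> - x \<alpha>) \<le> \<bar>e - w \<alpha>\<bar> + \<bar>e - w \<alpha>\<bar>" .
    have "inf \<bar>e - w \<alpha>\<bar> \<bar>w \<alpha>\<bar> = 0" using abs.laterally_converges_limit[OF di lc in\<Lambda>(1)] .
    then have "inf (\<bar>e - w \<alpha>\<bar> + \<bar>e - w \<alpha>\<bar>) \<bar>w \<alpha>\<bar> = 0" by (intro disjoint_add)
    then have "inf (p (x \<beta> - x \<alpha>)) (p (x \<alpha>)) = 0"
      using disjoint_below le x(1)[OF in\<Lambda>(1)] norm_nonneg by blast
    then show ?thesis unfolding disjoint_elements_abs_iff .
  qed
  ultimately show ?thesis unfolding laterally_converges_def by blast
qed

end

lemma decreasing_to_zero_lower_bound: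
  assumes "decreasing_to_zero \<Gamma> s e" "\<And>\<gamma>. \<gamma> \<in> \<Gamma> \<Longrightarrow> x \<le> e \<gamma>"
  shows "x \<le> 0"
  using assms unfolding decreasing_to_zero_def isGlb_def isLb_def greatestP_def setle_def setge_def
  by simp

text \<open>A lower bound of a finite sum of nets that converge to zero in order is nonpositive. The
  bound is only required eventually so that the summands can be removed one at a time, the one
  being removed replaced by its order bound.\<close>

lemma sum_bo_null_lower_bound:
  fixes q :: "'w::real_vector \<Rightarrow> 'e::archimedean_vector_lattice"
  assumes di: "directed_index \<Lambda> r"
    and null: "\<And>v. v \<in> set vs \<Longrightarrow> bo_converges q \<Lambda> r (g v) (l v)"
    and "\<alpha>\<^sub>0 \<in> \<Lambda>" "\<And>\<alpha>. \<alpha> \<in> \<Lambda> \<Longrightarrow> (\<alpha>\<^sub>0, \<alpha>) \<in> r \<Longrightarrow> x \<le> (\<Sum>v\<leftarrow>vs. q (l v - g v \<alpha>))"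
  shows "x \<le> 0"
  using null assms(3,4)
proof (induction vs arbitrary: x \<alpha>\<^sub>0)
  case Nil
  have "(\<alpha>\<^sub>0, \<alpha>\<^sub>0) \<in> r"
    using di Nil unfolding directed_index_def preorder_on_def refl_on_def by auto
  then show ?case using Nil by fastforce
next
  case (Cons v vs)
  have tr: "trans r" using di unfolding directed_index_def preorder_on_def by auto
  obtain G :: "'e set" and s e where dz: "decreasing_to_zero G s e"
    and ev: "\<forall>\<gamma>\<in>G. \<exists>\<alpha>\<^sub>0\<in>\<Lambda>. \<forall>\<alpha>\<in>\<Lambda>. (\<alpha>\<^sub>0, \<alpha>) \<in> r \<longrightarrow> q (l v - g v \<alpha>) \<le> e \<gamma>"
    using Cons.prems(1)[of v] unfolding bo_converges_def by auto
  show ?case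
  proof (rule decreasing_to_zero_lower_bound[OF dz])
    fix \<gamma> assume "\<gamma> \<in> G"
    then obtain a where a: "a \<in> \<Lambda>" "\<And>\<alpha>. \<alpha> \<in> \<Lambda> \<Longrightarrow> (a, \<alpha>) \<in> r \<Longrightarrow> q (l v - g v \<alpha>) \<le> e \<gamma>"
      using ev by blast
    obtain b where b: "b \<in> \<Lambda>" "(a, b) \<in> r" "(\<alpha>\<^sub>0, b) \<in> r"
      using di a(1) Cons.prems(2) unfolding directed_index_def by blast
    have "x - e \<gamma> \<le> (\<Sum>v\<leftarrow>vs. q (l v - g v \<alpha>))" if \<alpha>: "\<alpha> \<in> \<Lambda>" "(b, \<alpha>) \<in> r" for \<alpha>
    proof -
      have "(a, \<alpha>) \<in> r" "(\<alpha>\<^sub>0, \<alpha>) \<in> r" using tr b \<alpha>(2) by (meson transD)+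
      then have "x \<le> q (l v - g v \<alpha>) + (\<Sum>v\<leftarrow>vs. q (l v - g v \<alpha>))" "q (l v - g v \<alpha>) \<le> e \<gamma>"
        using Cons.prems(3) a(2) \<alpha>(1) by simp_all
      then have "x \<le> e \<gamma> + (\<Sum>v\<leftarrow>vs. q (l v - g v \<alpha>))" by (meson add_right_mono order_trans)
      then show ?thesis by (simp add: diff_le_eq add.commute)
    qed
    then have "x - e \<gamma> \<le> 0" by (intro Cons.IH[OF Cons.prems(1) b(1)]) auto
    then show "x \<le> e \<gamma>" by simp
  qed
qed


section \<open>The exact dominant as a variation\<close>

text \<open>The equation \<open>inf m (e - m) = 0\<close> for the total norm \<open>m\<close> of the family makes \<open>m\<close> a
  fragment of \<open>e\<close>; it contains the inequalities \<open>0 \<le> m\<close> and \<open>m \<le> e\<close>.\<close>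

definition fragment_family ::
  "('v::real_vector \<Rightarrow> 'e::archimedean_vector_lattice) \<Rightarrow> 'e \<Rightarrow> 'v list \<Rightarrow> bool" where
  "fragment_family p e vs \<longleftrightarrow> sorted_wrt (disjoint_elements p) vs \<and>
     inf (\<Sum>v\<leftarrow>vs. p v) (e - (\<Sum>v\<leftarrow>vs. p v)) = 0"

definition variation ::
  "('v::real_vector \<Rightarrow> 'e::archimedean_vector_lattice) \<Rightarrow>
   ('w::real_vector \<Rightarrow> 'f::{archimedean_vector_lattice, conditionally_complete_lattice}) \<Rightarrow>
   ('v \<Rightarrow> 'w) \<Rightarrow> 'e \<Rightarrow> 'f" where
  "variation p q T e = (SUP vs \<in> {vs. fragment_family p \<bar>e\<bar> vs}. \<Sum>v\<leftarrow>vs. q (T v))"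

lemma fragment_family_total_le:
  assumes "fragment_family p e vs"
  shows "(\<Sum>v\<leftarrow>vs. p v) \<le> e"
proof -
  have "0 \<le> e - (\<Sum>v\<leftarrow>vs. p v)"
    using assms unfolding fragment_family_def by (metis inf.cobounded2)
  then show ?thesis by simp
qed

context lattice_normed_space
begin

lemma fragment_family_Nil: "0 \<le> e \<Longrightarrow> fragment_family p e []"
  by (simp add: fragment_family_def inf_absorb1)

lemma fragment_family_singleton: "fragment_family p (p v) [v]"
  by (simp add: fragment_family_def norm_nonneg inf_absorb2)

lemma total_norm_nonneg: "0 \<le> (\<Sum>v\<leftarrow>vs. p v)"
  by (induction vs) (simp_all add: norm_nonneg)

lemma member_norm_le_total: "v \<in> set vs \<Longrightarrow> p v \<le> (\<Sum>v\<leftarrow>vs. p v)"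
proof (induction vs)
  case (Cons u us)
  then show ?case
    using total_norm_nonneg[of us] norm_nonneg[of u] by (auto intro: add_increasing add_increasing2)
qed simp

lemma fragment_family_append:
  assumes us: "fragment_family p a us" and vs: "fragment_family p b vs" and ab: "inf a b = 0"
  shows "fragment_family p (a + b) (us @ vs)"
proof -
  define m n where "m = (\<Sum>v\<leftarrow>us. p v)" and "n = (\<Sum>v\<leftarrow>vs. p v)"
  have le: "m \<le> a" "n \<le> b" "0 \<le> m" "0 \<le> n"
    using fragment_family_total_le[OF us] fragment_family_total_le[OF vs] total_norm_nonneg
    by (auto simp: m_def n_def)
  have "disjoint_elements p u v" if "u \<in> set us" "v \<in> set vs" for u v
  proof -
    have "p u \<le> a" "p v \<le> b"
      using member_norm_le_total[OF that(1)] member_norm_le_total[OF that(2)] le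
      by (auto simp: m_def n_def intro: order_trans)
    then show ?thesis
      unfolding disjoint_elements_def using disjoint_below[OF ab] norm_nonneg by blast
  qed
  then have "sorted_wrt (disjoint_elements p) (us @ vs)"
    using us vs by (auto simp: fragment_family_def sorted_wrt_append)
  moreover have "inf (m + n) ((a - m) + (b - n)) = 0"
  proof -
    have "inf m (a - m) = 0" "inf n (b - n) = 0"
      using us vs by (auto simp: fragment_family_def m_def n_def)
    moreover have "inf m (b - n) = 0" "inf (a - m) n = 0"
      using disjoint_below[OF ab] le by simp_all
    ultimately have "inf (a - m) (m + n) = 0" "inf (b - n) (m + n) = 0"
      using disjoint_add[of m "a - m" n] disjoint_add[of m "b - n" n] by (simp_all add: inf_commute)
    then have "inf ((a - m) + (b - n)) (m + n) = 0" by (rule disjoint_add)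
    then show ?thesis by (simp add: inf_commute)
  qed
  ultimately show ?thesis
    by (simp add: fragment_family_def m_def n_def algebra_simps)
qed

text \<open>The parts \<open>f v\<close> under \<open>a\<close> form an admissible family for \<open>a\<close>: what their total norm misses
  of \<open>a\<close> is a portion of what the total norm of the given family misses of \<open>a + b\<close>.\<close>

lemma fragment_family_cut:
  assumes vs: "fragment_family p (a + b) vs" and ab: "inf a b = 0"
    and f: "\<And>v. v \<in> set vs \<Longrightarrow> p (f v) = inf (p v) a \<and> p (v - f v) = inf (p v) b"
  shows "fragment_family p a (map f vs)"
proof -
  have nn: "0 \<le> a" "0 \<le> b" using ab by (metis inf.cobounded1, metis inf.cobounded2)
  have below: "(\<Sum>v\<leftarrow>vs. p (h v)) \<le> c"
    and sorted: "sorted_wrt (disjoint_elements p) (map h vs)"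
    if "\<And>v. v \<in> set vs \<Longrightarrow> p (h v) \<le> p v \<and> p (h v) \<le> c" "0 \<le> c" for h c
  proof -
    have "sorted_wrt (\<lambda>u v. inf (p (h u)) (p (h v)) = 0) vs"
    proof (rule sorted_wrt_mono_rel)
      show "sorted_wrt (disjoint_elements p) vs" using vs unfolding fragment_family_def by simp
      show "inf (p (h u)) (p (h v)) = 0"
        if uv: "u \<in> set vs" "v \<in> set vs" "disjoint_elements p u v" for u v
        using disjoint_below[of "p u" "p v"] uv \<open>\<And>v. v \<in> set vs \<Longrightarrow> p (h v) \<le> p v \<and> p (h v) \<le> c\<close>
          norm_nonneg unfolding disjoint_elements_def by blast
    qed
    moreover from this have "sorted_wrt (\<lambda>a b. inf a b = 0) (map (\<lambda>v. p (h v)) vs)"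
      by (simp add: sorted_wrt_map)
    then show "(\<Sum>v\<leftarrow>vs. p (h v)) \<le> c"
      by (rule disjoint_sum_list_le) (use that norm_nonneg in auto)
    ultimately show "sorted_wrt (disjoint_elements p) (map h vs)"
      by (simp add: sorted_wrt_map disjoint_elements_def)
  qed
  define m n where "m = (\<Sum>v\<leftarrow>vs. p (f v))" and "n = (\<Sum>v\<leftarrow>vs. p (v - f v))"
  have mn: "m \<le> a" "n \<le> b" "0 \<le> m" "0 \<le> n"
    unfolding m_def n_def using below f nn
    by (auto intro!: sum_list_nonneg simp: norm_nonneg)
  have "p v = p (f v) + p (v - f v)" if "v \<in> set vs" for v
    using inf_disjoint_add[OF norm_nonneg ab]
      order_trans[OF member_norm_le_total[OF that] fragment_family_total_le[OF vs]] f[OF that] by simp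
  then have "(\<Sum>v\<leftarrow>vs. p v) = (\<Sum>v\<leftarrow>vs. p (f v) + p (v - f v))"
    by (intro arg_cong[of _ _ sum_list] map_cong) auto
  then have total: "(\<Sum>v\<leftarrow>vs. p v) = m + n" by (simp add: m_def n_def sum_list_addf)
  have frag: "inf (m + n) ((a + b) - (m + n)) = 0" using vs unfolding fragment_family_def total by simp
  have le: "a - m \<le> (a + b) - (m + n)"
    using add_left_mono[OF mn(2), of "a - m"] by (simp add: algebra_simps)
  have "0 \<le> a - m" "m \<le> m + n" using mn by simp_all
  then have "inf m (a - m) = 0" using disjoint_below[OF frag mn(3) _ _ le] by blast
  then show ?thesis
    using sorted[of f a] f nn unfolding fragment_family_def m_def by (simp add: comp_def)
qed

end

locale decomposable_dominated =
  V: lattice_normed_space p + W: lattice_normed_space q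
  for p :: "'v::real_vector \<Rightarrow> 'e::archimedean_vector_lattice"
    and q :: "'w::real_vector \<Rightarrow> 'f::{archimedean_vector_lattice, conditionally_complete_lattice}" +
  fixes T :: "'v \<Rightarrow> 'w"
  assumes decomp: "decomposable p" and dominated: "dominated_uryson p q T"
begin

lemma T_disjoint_add: "inf (p u) (p v) = 0 \<Longrightarrow> T (u + v) = T u + T v"
  using dominated unfolding dominated_uryson_def orthogonally_additive_def disjoint_elements_def
  by blast

lemma family_sum_le_dominant:
  assumes S: "dominant p q T S" and vs: "fragment_family p \<bar>e\<bar> vs"
  shows "(\<Sum>v\<leftarrow>vs. q (T v)) \<le> S e"
proof -
  have oa: "orthogonally_additive abs S" and even: "even_op S" and pos: "0 \<le> S a" for a
    using S unfolding dominant_def uryson_pos_even_def abstract_uryson_def positive_op_def by auto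
  have add: "S (a + b) = S a + S b" if "inf a b = 0" for a b
  proof -
    have "0 \<le> a" "0 \<le> b" using that by (metis inf.cobounded1, metis inf.cobounded2)
    then show ?thesis
      using oa that unfolding orthogonally_additive_def disjoint_elements_def by simp
  qed
  have dom: "q (T v) \<le> S (p v)" for v using S unfolding dominant_def by blast
  have "sorted_wrt (disjoint_elements p) us \<Longrightarrow> (\<Sum>v\<leftarrow>us. q (T v)) \<le> S (\<Sum>v\<leftarrow>us. p v)" for us
  proof (induction us)
    case (Cons u us)
    have "inf (\<Sum>v\<leftarrow>us. p v) (p u) = 0"
      using Cons.prems
      by (intro disjoint_sum_list) (auto simp: V.norm_nonneg disjoint_elements_def inf_commute)
    then have "S (p u + (\<Sum>v\<leftarrow>us. p v)) = S (p u) + S (\<Sum>v\<leftarrow>us. p v)"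
      by (intro add) (simp add: inf_commute)
    then show ?case using Cons dom by (simp add: add_mono)
  qed (simp add: pos)
  then have "(\<Sum>v\<leftarrow>vs. q (T v)) \<le> S (\<Sum>v\<leftarrow>vs. p v)"
    using vs unfolding fragment_family_def by blast
  also have "\<dots> \<le> S (\<Sum>v\<leftarrow>vs. p v) + S (\<bar>e\<bar> - (\<Sum>v\<leftarrow>vs. p v))" by (simp add: pos)
  also have "\<dots> = S \<bar>e\<bar>" using add vs unfolding fragment_family_def by fastforce
  also have "\<dots> = S e" using even_orthogonally_additive_abs[OF oa even] .
  finally show ?thesis .
qed

abbreviation "var \<equiv> variation p q T"

lemma family_sum_le_variation:
  assumes "fragment_family p \<bar>e\<bar> vs"
  shows "(\<Sum>v\<leftarrow>vs. q (T v)) \<le> var e"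
proof -
  obtain S where "dominant p q T S" using dominated unfolding dominated_uryson_def by blast
  then have "bdd_above ((\<lambda>vs. \<Sum>v\<leftarrow>vs. q (T v)) ` {vs. fragment_family p \<bar>e\<bar> vs})"
    using family_sum_le_dominant by (intro bdd_aboveI2[of _ _ "S e"]) simp
  then show ?thesis unfolding variation_def by (intro cSUP_upper) (simp_all add: assms)
qed

lemma variation_least:
  assumes "\<And>vs. fragment_family p \<bar>e\<bar> vs \<Longrightarrow> (\<Sum>v\<leftarrow>vs. q (T v)) \<le> x"
  shows "var e \<le> x"
proof -
  have "{vs. fragment_family p \<bar>e\<bar> vs} \<noteq> {}" using V.fragment_family_Nil[of "\<bar>e\<bar>"] by auto
  then show ?thesis unfolding variation_def by (intro cSUP_least) (auto simp: assms)
qed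

lemma variation_nonneg: "0 \<le> var e"
  using family_sum_le_variation[of e "[]"] V.fragment_family_Nil[of "\<bar>e\<bar>"] by simp

lemma variation_le_dominant: "dominant p q T S \<Longrightarrow> var e \<le> S e"
  by (intro variation_least family_sum_le_dominant)

lemma norm_le_variation: "q (T v) \<le> var (p v)"
  using family_sum_le_variation[of "p v" "[v]"] V.fragment_family_singleton[of v]
  by (simp add: V.norm_nonneg)

text \<open>One cutting function serves all vectors under \<open>a + b\<close> at once; \<open>v - f v\<close> is then the
  corresponding function for the other half.\<close>

lemma cutting_function:
  assumes "inf a b = 0"
  obtains f where "\<And>v. p v \<le> a + b \<Longrightarrow> p (f v) = inf (p v) a"
    "\<And>v. p v \<le> a + b \<Longrightarrow> p (v - f v) = inf (p v) b"
    "\<And>v. p v \<le> a + b \<Longrightarrow> T v = T (f v) + T (v - f v)"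
proof -
  have nn: "0 \<le> a" "0 \<le> b" using assms by (metis inf.cobounded1, metis inf.cobounded2)
  have "\<exists>f. \<forall>v. p v \<le> a + b \<longrightarrow> p (f v) = inf (p v) a \<and> p (v - f v) = inf (p v) b"
    using V.decompose_disjoint[OF decomp assms] by metis
  then obtain f
    where f: "\<And>v. p v \<le> a + b \<Longrightarrow> p (f v) = inf (p v) a \<and> p (v - f v) = inf (p v) b" by blast
  have "T v = T (f v) + T (v - f v)" if "p v \<le> a + b" for v
  proof -
    have "inf (p (f v)) (p (v - f v)) = 0"
      using f[OF that] V.norm_nonneg nn by (intro disjoint_below[OF assms]) auto
    from T_disjoint_add[OF this] show ?thesis by simp
  qed
  then show ?thesis using that f by blast
qed

lemma variation_disjoint_add:
  assumes ef: "inf \<bar>e\<bar> \<bar>f\<bar> = 0"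
  shows "var (e + f) = var e + var f"
proof (rule antisym)
  have abs: "\<bar>e + f\<bar> = \<bar>e\<bar> + \<bar>f\<bar>" by (rule abs.norm_disjoint_add[OF ef])
  obtain c where c: "\<And>v. p v \<le> \<bar>e\<bar> + \<bar>f\<bar> \<Longrightarrow> p (c v) = inf (p v) \<bar>e\<bar>"
    "\<And>v. p v \<le> \<bar>e\<bar> + \<bar>f\<bar> \<Longrightarrow> p (v - c v) = inf (p v) \<bar>f\<bar>"
    "\<And>v. p v \<le> \<bar>e\<bar> + \<bar>f\<bar> \<Longrightarrow> T v = T (c v) + T (v - c v)"
    using cutting_function[OF ef] by blast
  show "var (e + f) \<le> var e + var f"
  proof (rule variation_least)
    fix vs assume "fragment_family p \<bar>e + f\<bar> vs"
    then have vs: "fragment_family p (\<bar>e\<bar> + \<bar>f\<bar>) vs" by (simp add: abs)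
    have le: "p v \<le> \<bar>e\<bar> + \<bar>f\<bar>" if "v \<in> set vs" for v
      using V.member_norm_le_total[OF that] fragment_family_total_le[OF vs] by (rule order_trans)
    have "(\<Sum>v\<leftarrow>vs. q (T v)) \<le> (\<Sum>v\<leftarrow>vs. q (T (c v)) + q (T (v - c v)))"
      using c(3) le W.norm_triangle by (intro sum_list_mono) simp
    also have "\<dots> = (\<Sum>v\<leftarrow>map c vs. q (T v)) + (\<Sum>v\<leftarrow>map (\<lambda>v. v - c v) vs. q (T v))"
      by (simp add: sum_list_addf comp_def)
    also have "\<dots> \<le> var e + var f"
    proof (intro add_mono family_sum_le_variation)
      show "fragment_family p \<bar>e\<bar> (map c vs)"
        by (rule V.fragment_family_cut[OF vs ef]) (simp add: c le)
      show "fragment_family p \<bar>f\<bar> (map (\<lambda>v. v - c v) vs)"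
        by (rule V.fragment_family_cut[of _ "\<bar>e\<bar>"])
          (use vs ef in \<open>simp_all add: c le add.commute inf_commute\<close>)
    qed
    finally show "(\<Sum>v\<leftarrow>vs. q (T v)) \<le> var e + var f" .
  qed
  have "var e \<le> var (e + f) - var f"
  proof (rule variation_least)
    fix us assume us: "fragment_family p \<bar>e\<bar> us"
    have "var f \<le> var (e + f) - (\<Sum>v\<leftarrow>us. q (T v))"
    proof (rule variation_least)
      fix vs assume "fragment_family p \<bar>f\<bar> vs"
      then have "fragment_family p \<bar>e + f\<bar> (us @ vs)"
        unfolding abs using V.fragment_family_append us ef by blast
      from family_sum_le_variation[OF this]
      show "(\<Sum>v\<leftarrow>vs. q (T v)) \<le> var (e + f) - (\<Sum>v\<leftarrow>us. q (T v))"
        by (simp add: le_diff_eq add.commute)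
    qed
    then show "(\<Sum>v\<leftarrow>us. q (T v)) \<le> var (e + f) - var f"
      by (simp add: le_diff_eq add.commute)
  qed
  then show "var e + var f \<le> var (e + f)" by (simp add: le_diff_eq)
qed

lemma variation_order_bounded: "order_bounded_op var"
  unfolding order_bounded_op_def
proof (intro allI impI)
  fix A :: "'e set" assume A: "bdd_below A \<and> bdd_above A"
  obtain S where S: "dominant p q T S" using dominated unfolding dominated_uryson_def by blast
  then have "order_bounded_op S"
    unfolding dominant_def uryson_pos_even_def abstract_uryson_def by blast
  then have "bdd_above (S ` A)" using A unfolding order_bounded_op_def by simp
  then obtain M where "\<And>a. a \<in> A \<Longrightarrow> S a \<le> M" unfolding bdd_above_def by blast
  then have "bdd_above (var ` A)"
    using variation_le_dominant[OF S] by (intro bdd_aboveI2[of _ _ M]) (meson order_trans)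
  moreover have "bdd_below (var ` A)" using variation_nonneg by (intro bdd_belowI2)
  ultimately show "bdd_below (var ` A) \<and> bdd_above (var ` A)" by simp
qed

lemma variation_uryson_pos_even: "var \<in> uryson_pos_even"
proof -
  have "orthogonally_additive abs var"
    unfolding orthogonally_additive_def disjoint_elements_def using variation_disjoint_add by blast
  moreover have "even_op var" unfolding even_op_def variation_def by simp
  ultimately show ?thesis
    unfolding uryson_pos_even_def abstract_uryson_def positive_op_def
    using variation_order_bounded variation_nonneg by blast
qed

lemma exact_dominant_eq_variation: "exact_dominant p q T = var"
  unfolding exact_dominant_def
proof (rule the_equality)
  have dom: "dominant p q T var"
    unfolding dominant_def using variation_uryson_pos_even norm_le_variation by blast
  have "uryson_le var S" if "dominant p q T S" for S
    unfolding uryson_le_def positive_op_def using variation_le_dominant[OF that] by simp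
  then show "dominant p q T var \<and> (\<forall>S. dominant p q T S \<longrightarrow> uryson_le var S)"
    using dom by blast
  fix S assume S: "dominant p q T S \<and> (\<forall>S'. dominant p q T S' \<longrightarrow> uryson_le S S')"
  then have "uryson_le S var" using dom by blast
  then have "S e \<le> var e" for e unfolding uryson_le_def positive_op_def by simp
  moreover have "var e \<le> S e" for e using S variation_le_dominant by blast
  ultimately show "S = var" by (intro ext) (rule antisym)
qed


section \<open>Lateral continuity of the operator and of its exact dominant\<close>

lemma variation_lateral_diff:
  assumes "directed_index \<Lambda> r" "laterally_converges abs \<Lambda> r w e" "\<alpha> \<in> \<Lambda>"
  shows "var e - var (w \<alpha>) = var (e - w \<alpha>)"
  using variation_disjoint_add[of "e - w \<alpha>" "w \<alpha>"] abs.laterally_converges_limit[OF assms]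
  by simp

lemma laterally_continuous_if_variation:
  assumes cont: "laterally_continuous abs abs var"
  shows "laterally_continuous p q T"
  unfolding laterally_continuous_def
proof (intro allI impI)
  fix \<Lambda> :: "'v set" and r v l
  assume di: "directed_index \<Lambda> r" and lc: "laterally_converges p \<Lambda> r v l"
  have lc': "laterally_converges abs \<Lambda> r (\<lambda>\<alpha>. p (v \<alpha>)) (p l)"
    using V.norm_laterally_converges[OF di lc] .
  have le: "q (T l - T (v \<alpha>)) \<le> \<bar>var (p l) - var (p (v \<alpha>))\<bar>" if \<alpha>: "\<alpha> \<in> \<Lambda>" for \<alpha>
  proof -
    have dj: "inf (p (l - v \<alpha>)) (p (v \<alpha>)) = 0" using V.laterally_converges_limit[OF di lc \<alpha>] .
    have "T l - T (v \<alpha>) = T (l - v \<alpha>)" using T_disjoint_add[OF dj] by simp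
    then have "q (T l - T (v \<alpha>)) \<le> var (p (l - v \<alpha>))" using norm_le_variation by simp
    also have "\<dots> = var (p l) - var (p (v \<alpha>))"
      using variation_lateral_diff[OF di lc' \<alpha>] V.norm_disjoint_add[OF dj] by simp
    finally show ?thesis using abs_ge_self order_trans by blast
  qed
  obtain G :: "'f set" and s e where dz: "decreasing_to_zero G s e"
    and ev: "\<forall>\<gamma>\<in>G. \<exists>\<alpha>\<^sub>0\<in>\<Lambda>. \<forall>\<alpha>\<in>\<Lambda>. (\<alpha>\<^sub>0, \<alpha>) \<in> r \<longrightarrow> \<bar>var (p l) - var (p (v \<alpha>))\<bar> \<le> e \<gamma>"
    using abs.laterally_continuousD[OF cont di lc'] unfolding bo_converges_def by blast
  show "bo_converges q \<Lambda> r (\<lambda>\<alpha>. T (v \<alpha>)) (T l)"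
  proof (rule bo_convergesI[OF dz])
    fix \<gamma> assume "\<gamma> \<in> G"
    then show "\<exists>\<alpha>\<^sub>0\<in>\<Lambda>. \<forall>\<alpha>\<in>\<Lambda>. (\<alpha>\<^sub>0, \<alpha>) \<in> r \<longrightarrow> q (T l - T (v \<alpha>)) \<le> e \<gamma>"
      using ev le by (meson order_trans)
  qed
qed

text \<open>The inequality \<open>\<bar>T\<bar> e \<le> sup\<^sub>\<alpha> \<bar>T\<bar> (w\<^sub>\<alpha>)\<close>, stated for an arbitrary upper bound in place of
  the supremum.\<close>

lemma variation_le_lateral_bound:
  assumes cont: "laterally_continuous p q T"
    and di: "directed_index \<Lambda> r" and lc: "laterally_converges abs \<Lambda> r w e"
    and bound: "\<And>\<alpha>. \<alpha> \<in> \<Lambda> \<Longrightarrow> var (w \<alpha>) \<le> b"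
  shows "var e \<le> b"
proof (rule variation_least)
  fix vs assume vs: "fragment_family p \<bar>e\<bar> vs"
  have dj: "inf \<bar>w \<alpha>\<bar> \<bar>e - w \<alpha>\<bar> = 0" and split: "\<bar>e\<bar> = \<bar>w \<alpha>\<bar> + \<bar>e - w \<alpha>\<bar>" if "\<alpha> \<in> \<Lambda>" for \<alpha>
    using abs.laterally_converges_limit[OF di lc that] abs.norm_disjoint_add[of "w \<alpha>" "e - w \<alpha>"]
    by (simp_all add: inf_commute)
  have "\<exists>c. \<forall>v. p v \<le> \<bar>e\<bar> \<longrightarrow> p (c v) = inf (p v) \<bar>w \<alpha>\<bar> \<and> p (v - c v) = inf (p v) \<bar>e - w \<alpha>\<bar>"
    if "\<alpha> \<in> \<Lambda>" for \<alpha>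
    using V.decompose_disjoint[OF decomp dj[OF that]] split[OF that] by metis
  then obtain c where c: "\<And>\<alpha> v. \<alpha> \<in> \<Lambda> \<Longrightarrow> p v \<le> \<bar>e\<bar> \<Longrightarrow>
      p (c \<alpha> v) = inf (p v) \<bar>w \<alpha>\<bar> \<and> p (v - c \<alpha> v) = inf (p v) \<bar>e - w \<alpha>\<bar>"
    by metis
  have le: "p v \<le> \<bar>e\<bar>" if "v \<in> set vs" for v
    using V.member_norm_le_total[OF that] fragment_family_total_le[OF vs] by (rule order_trans)
  have "laterally_converges p \<Lambda> r (\<lambda>\<alpha>. c \<alpha> v) v" if "v \<in> set vs" for v
    by (rule V.laterally_converges_cut[OF di lc]) (simp_all add: c le[OF that])
  then have conv: "bo_converges q \<Lambda> r (\<lambda>\<alpha>. T (c \<alpha> v)) (T v)" if "v \<in> set vs" for v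
    using V.laterally_continuousD[OF cont di] that by blast
  have est: "(\<Sum>v\<leftarrow>vs. q (T v)) - b \<le> (\<Sum>v\<leftarrow>vs. q (T v - T (c \<alpha> v)))" if \<alpha>: "\<alpha> \<in> \<Lambda>" for \<alpha>
  proof -
    have "q (T v) \<le> q (T (c \<alpha> v)) + q (T v - T (c \<alpha> v))" for v
      using W.norm_triangle[of "T (c \<alpha> v)" "T v - T (c \<alpha> v)"] by simp
    then have "(\<Sum>v\<leftarrow>vs. q (T v)) \<le> (\<Sum>v\<leftarrow>vs. q (T (c \<alpha> v)) + q (T v - T (c \<alpha> v)))"
      by (intro sum_list_mono)
    also have "\<dots> = (\<Sum>v\<leftarrow>map (c \<alpha>) vs. q (T v)) + (\<Sum>v\<leftarrow>vs. q (T v - T (c \<alpha> v)))"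
      by (simp add: sum_list_addf comp_def)
    also have "(\<Sum>v\<leftarrow>map (c \<alpha>) vs. q (T v)) \<le> var (w \<alpha>)"
      using vs unfolding split[OF \<alpha>]
      by (intro family_sum_le_variation V.fragment_family_cut[OF _ dj[OF \<alpha>]])
        (simp_all add: c le \<alpha>)
    also have "var (w \<alpha>) \<le> b" using bound[OF \<alpha>] .
    finally show ?thesis by (simp add: diff_le_eq add.commute)
  qed
  obtain \<alpha>\<^sub>0 where "\<alpha>\<^sub>0 \<in> \<Lambda>" using di unfolding directed_index_def by blast
  then have "(\<Sum>v\<leftarrow>vs. q (T v)) - b \<le> 0"
    using est
    by (intro sum_bo_null_lower_bound[where vs = vs and q = q and l = T and g = "\<lambda>v \<alpha>. T (c \<alpha> v)",
          OF di conv])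
  then show "(\<Sum>v\<leftarrow>vs. q (T v)) \<le> b" by simp
qed

lemma variation_laterally_continuous:
  assumes cont: "laterally_continuous p q T"
  shows "laterally_continuous abs abs var"
  unfolding laterally_continuous_def
proof (intro allI impI)
  fix \<Lambda> :: "'e set" and r w and e :: 'e
  assume di: "directed_index \<Lambda> r" and lc: "laterally_converges abs \<Lambda> r w e"
  have anti: "var e - var (w \<beta>) \<le> var e - var (w \<alpha>)" if "(\<alpha>, \<beta>) \<in> r" for \<alpha> \<beta>
  proof -
    have "inf \<bar>w \<beta> - w \<alpha>\<bar> \<bar>w \<alpha>\<bar> = 0"
      using lc that unfolding laterally_converges_def abs.disjoint_elements_abs_iff by blast
    then have "var (w \<beta>) = var (w \<beta> - w \<alpha>) + var (w \<alpha>)"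
      using variation_disjoint_add[of "w \<beta> - w \<alpha>" "w \<alpha>"] by simp
    then show ?thesis using variation_nonneg[of "w \<beta> - w \<alpha>"] by simp
  qed
  have nonneg: "0 \<le> var e - var (w \<alpha>)" if "\<alpha> \<in> \<Lambda>" for \<alpha>
    using variation_lateral_diff[OF di lc that] variation_nonneg by simp
  have "x \<le> 0" if "\<And>\<alpha>. \<alpha> \<in> \<Lambda> \<Longrightarrow> x \<le> var e - var (w \<alpha>)" for x
  proof -
    have "var e \<le> var e - x"
      using that
      by (intro variation_le_lateral_bound[OF cont di lc]) (simp add: le_diff_eq add.commute)
    then show ?thesis by simp
  qed
  then have dz: "decreasing_to_zero \<Lambda> r (\<lambda>\<alpha>. var e - var (w \<alpha>))"
    using di anti nonneg
    unfolding decreasing_to_zero_def isGlb_def isLb_def greatestP_def setle_def setge_def by simp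
  show "bo_converges abs \<Lambda> r (\<lambda>\<alpha>. var (w \<alpha>)) (var e)"
  proof (rule bo_convergesI[OF dz])
    fix \<gamma> assume "\<gamma> \<in> \<Lambda>"
    moreover have "\<bar>var e - var (w \<alpha>)\<bar> \<le> var e - var (w \<gamma>)" if "\<alpha> \<in> \<Lambda>" "(\<gamma>, \<alpha>) \<in> r" for \<alpha>
      using anti[OF that(2)] nonneg[OF that(1)] by simp
    ultimately show "\<exists>\<alpha>\<^sub>0\<in>\<Lambda>. \<forall>\<alpha>\<in>\<Lambda>. (\<alpha>\<^sub>0, \<alpha>) \<in> r \<longrightarrow> \<bar>var e - var (w \<alpha>)\<bar> \<le> var e - var (w \<gamma>)"
      by blast
  qed
qed

end

theorem theorem6p3:
  fixes p :: "'v::real_vector \<Rightarrow> 'e::archimedean_vector_lattice"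
    and q :: "'w::real_vector \<Rightarrow> 'f::{archimedean_vector_lattice, conditionally_complete_lattice}"
    and T :: "'v \<Rightarrow> 'w"
  assumes "lattice_normed_space p" and "decomposable p"
    and "banach_kantorovich q"
    and "dominated_uryson p q T"
  shows "(laterally_continuous p q T \<longleftrightarrow> laterally_continuous abs abs (exact_dominant p q T)) \<and>
         (T \<in> lat_cont_dominated p q \<longleftrightarrow> exact_dominant p q T \<in> lat_cont_uryson_pos)"
proof -
  interpret V: lattice_normed_space p by fact
  interpret W: lattice_normed_space q using assms(3) unfolding banach_kantorovich_def by blast
  interpret decomposable_dominated p q T by unfold_locales fact+
  have "laterally_continuous p q T \<longleftrightarrow> laterally_continuous abs abs (exact_dominant p q T)"
    unfolding exact_dominant_eq_variation
    using laterally_continuous_if_variation variation_laterally_continuous by blast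
  moreover have "exact_dominant p q T \<in> uryson_pos_even"
    unfolding exact_dominant_eq_variation by (rule variation_uryson_pos_even)
  ultimately show ?thesis
    using assms(4)
    unfolding lat_cont_dominated_def lat_cont_uryson_pos_def uryson_pos_even_def by auto
qed

end
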